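(* Let $q=p^{km}$, where $p$ is an odd prime and $k,m$ are positive integers. Let $t$ be a positive integer with $2t\mid (p^{k}-1)$ and let $e$ be an integer with $0\leq e\leq m-1$. If $\frac{q-1}{2t}$ is even, then there exists a $q$-ary MDS self-dual code of length $2tp^{ke}$.
   Context: $\mathbb{F}_q$ denotes the finite field with $q$ elements. A $q$-ary $[n,\kappa,d]$ code is an $\mathbb{F}_q$-linear subspace $C\subseteq\mathbb{F}_q^n$ of dimension $\kappa$ with minimum (Hamming) distance $d$; $n$ is its length. It is called MDS (maximum distance separable) if $\kappa+d=n+1$. The dual $C^{\perp}$ is the orthogonal complement of $C$ in $\mathbb{F}_q^n$ with respect to the standard Euclidean bilinear form $\langle x,y\rangle=\sum_{i=1}^n x_iy_i$, and $C$ is self-dual if $C=C^{\perp}$. An MDS self-dual code of length $n$ thus has parameters $[n,\frac n2,\frac n2+1]$. *)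

theory Defs
  imports "HOL-Library.Cardinality" "Jordan_Normal_Form.VS_Connect"
begin

definition hamming_distance :: "'a vec \<Rightarrow> 'a vec \<Rightarrow> nat" where
  "hamming_distance x y = card {i. i < dim_vec x \<and> x $ i \<noteq> y $ i}"

(* Inf on nat is the least element. It is only meaningful for a code with at least two
   codewords: for other codes the set is empty and the value is the junk value Inf {} = 0. *)
definition minimum_distance :: "'a vec set \<Rightarrow> nat" where
  "minimum_distance C = Inf {hamming_distance x y | x y. x \<in> C \<and> y \<in> C \<and> x \<noteq> y}"

definition linear_code :: "nat \<Rightarrow> nat \<Rightarrow> nat \<Rightarrow> 'a :: field vec set \<Rightarrow> bool" where
  "linear_code n r d C \<longleftrightarrow>
     subspace class_ring C (module_vec TYPE('a) n) \<and>
     vectorspace.dim class_ring ((module_vec TYPE('a) n)\<lparr>carrier := C\<rparr>) = r \<and>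
     minimum_distance C = d"

definition MDS_code :: "nat \<Rightarrow> 'a :: field vec set \<Rightarrow> bool" where
  "MDS_code n C \<longleftrightarrow> (\<exists>r d. linear_code n r d C \<and> r + d = n + 1)"

(* The library's orthogonal complement is taken inside carrier_vec n with respect to the
   bilinear form scalar_prod (no conjugation). *)
definition dual_code :: "nat \<Rightarrow> 'a :: field vec set \<Rightarrow> 'a vec set" where
  "dual_code n C = vec_module.orthogonal_complement n C"

definition self_dual :: "nat \<Rightarrow> 'a :: field vec set \<Rightarrow> bool" where
  "self_dual n C \<longleftrightarrow> C = dual_code n C"

end

theory Submission
  imports Defs "Jordan_Normal_Form.DL_Rank" "HOL-Number_Theory.Residues"
begin

text \<open>
  Let \<open>r = p ^ k\<close> and let \<open>F\<close> be the subfield of order \<open>r\<close>. Take an \<open>F\<close>-subspace \<open>V\<close> of dimension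
  \<open>e\<close>, some \<open>b \<notin> V\<close>, and the group \<open>M\<close> of the \<open>2 t\<close>-th roots of unity, which lies in \<open>F\<close>. On
  the union \<open>A\<close> of the cosets \<open>u * b + V\<close> with \<open>u \<in> M\<close>, the product of \<open>a - c\<close> over \<open>c \<in> A - {a}\<close>
  equals \<open>K / u\<close> for a constant \<open>K\<close>, and \<open>u\<close> is a square because \<open>(q - 1) / (2 t)\<close> is even. So
  there are weights \<open>w\<close> with \<open>(w a)\<^sup>2\<close> equal to \<open>K\<close> divided by this product, and Lagrange
  interpolation turns the inner product of the weighted evaluation vectors of \<open>f\<close> and \<open>g\<close> into
  \<open>K\<close> times the coefficient of \<open>f * g\<close> at degree \<open>card A - 1\<close>. Hence the generalized
  Reed-Solomon code of polynomials of degree below \<open>card A / 2\<close> is self-dual: a polynomial \<open>f\<close> of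
  larger degree is not orthogonal to the monomial that brings \<open>f\<close> up to degree \<open>card A - 1\<close>.
\<close>

section \<open>Roots of unity in finite fields\<close>

text \<open>Multiplication by \<open>x\<close> permutes the nonzero elements, so it leaves their
  product unchanged while contributing one factor \<open>x\<close> for each of them.\<close>

lemma finite_field_power_eq_1:
  fixes x :: "'a :: {field, finite}"
  assumes "x \<noteq> 0"
  shows "x ^ (CARD('a) - 1) = 1"
proof -
  have "bij_betw ((*) x) (UNIV - {0}) (UNIV - {0})"
    by (rule bij_betw_byWitness[where f' = "(*) (inverse x)"]) (use assms in \<open>auto simp: field_simps\<close>)
  then have "(\<Prod>y\<in>UNIV-{0}. x * y) = \<Prod>(UNIV - {0})"
    by (rule prod.reindex_bij_betw)
  then show ?thesis
    by (simp add: prod.distrib card_Diff_singleton)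
qed

lemma degree_monom_minus_1:
  fixes n :: nat
  assumes "n > 0"
  shows "degree (Polynomial.monom 1 n - 1 :: 'a :: field poly) = n"
    and "Polynomial.monom 1 n - 1 \<noteq> (0 :: 'a :: field poly)"
proof -
  show *: "degree (Polynomial.monom 1 n - 1 :: 'a poly) = n"
    using assms degree_add_eq_left[of "-1" "Polynomial.monom 1 n :: 'a poly"]
    by (simp add: Polynomial.degree_monom_eq)
  show "Polynomial.monom 1 n - 1 \<noteq> (0 :: 'a :: field poly)"
    using assms * by force
qed

lemma card_roots_of_unity_le:
  assumes "n > 0"
  shows "card {x :: 'a :: field. x ^ n = 1} \<le> n"
  using card_poly_roots_bound[OF degree_monom_minus_1(2)[OF assms, where 'a = 'a]]
  by (simp add: degree_monom_minus_1[OF assms] Polynomial.poly_monom)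

text \<open>With \<open>N = CARD('a) - 1\<close>, the polynomial \<open>X ^ N - 1\<close> vanishes
  at all \<open>N\<close> nonzero elements and factors as \<open>X ^ d - 1\<close> times a geometric
  sum \<open>g\<close>. Since \<open>g\<close> has at most \<open>N - d\<close> roots, at least
  \<open>d\<close> elements are left for \<open>X ^ d - 1\<close>.\<close>

lemma card_roots_of_unity:
  assumes "d dvd CARD('a :: {field, finite}) - 1"
  shows "card {x :: 'a. x ^ d = 1} = d"
proof -
  define N where "N = CARD('a) - 1"
  have "card {0, 1 :: 'a} \<le> CARD('a)" by (rule card_mono) auto
  then have N: "N > 0" by (simp add: N_def)
  obtain c where c: "N = d * c" using assms by (auto simp: N_def)
  have d: "d > 0" and cpos: "c > 0" using N c by auto
  define g :: "'a poly" where "g = (\<Sum>i<c. Polynomial.monom 1 (d * i))"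
  have fac: "(x ^ d - 1) * poly g x = x ^ N - 1" for x :: 'a
    using power_diff_1_eq[of "x ^ d" c]
    by (simp add: g_def poly_sum Polynomial.poly_monom c power_mult)
  have deg: "degree g \<le> N - d"
    unfolding g_def
  proof (rule degree_sum_le)
    fix i assume "i \<in> {..<c}"
    then have "d * Suc i \<le> N" unfolding c by (intro mult_left_mono) auto
    then show "degree (Polynomial.monom (1 :: 'a) (d * i)) \<le> N - d"
      by (intro order.trans[OF Polynomial.degree_monom_le]) simp
  qed simp
  have "poly g 0 = 1"
  proof -
    have "poly g 0 = (\<Sum>i<c. if i = 0 then 1 else 0)"
      unfolding g_def poly_sum using d by (intro sum.cong) (auto simp: Polynomial.poly_monom power_0_left)
    then show ?thesis using cpos by simp
  qed
  then have "g \<noteq> 0" by auto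
  have "N = card (UNIV - {0 :: 'a})" by (simp add: N_def card_Diff_singleton)
  also have "\<dots> \<le> card ({x :: 'a. poly g x = 0} \<union> {x. x ^ d = 1})"
  proof (rule card_mono)
    show "UNIV - {0} \<subseteq> {x :: 'a. poly g x = 0} \<union> {x. x ^ d = 1}"
    proof
      fix x :: 'a assume "x \<in> UNIV - {0}"
      then have "(x ^ d - 1) * poly g x = 0"
        unfolding fac using finite_field_power_eq_1[of x] by (simp add: N_def)
      then show "x \<in> {x :: 'a. poly g x = 0} \<union> {x. x ^ d = 1}" by auto
    qed
  qed simp
  also have "\<dots> \<le> card {x :: 'a. poly g x = 0} + card {x :: 'a. x ^ d = 1}"
    by (rule card_Un_le)
  also have "\<dots> \<le> (N - d) + card {x :: 'a. x ^ d = 1}"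
    using card_poly_roots_bound[OF \<open>g \<noteq> 0\<close>] deg by linarith
  finally have "d \<le> card {x :: 'a. x ^ d = 1}"
    using c cpos by (cases c) auto
  then show ?thesis using card_roots_of_unity_le[OF d, where 'a = 'a] by simp
qed

text \<open>Put \<open>CARD('a) - 1 = 2 * h\<close>. Squaring is at most two-to-one, so there are at
  least \<open>h\<close> nonzero squares. All of them are among the at most \<open>h\<close> roots
  of \<open>X ^ h - 1\<close>, hence they are exactly these roots, and \<open>d\<close> divides
  \<open>h\<close>.\<close>

lemma root_of_unity_is_square:
  fixes u :: "'a :: {field, finite}"
  assumes "u ^ d = 1" and "2 * d dvd CARD('a) - 1"
  shows "\<exists>s. s\<^sup>2 = u"
proof -
  define N where "N = CARD('a) - 1"
  have "card {0, 1 :: 'a} \<le> CARD('a)" by (rule card_mono) auto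
  then have "N > 0" by (simp add: N_def)
  obtain h where h: "N = 2 * h" "d dvd h"
    using assms(2) by (auto simp: N_def)
  then have "h > 0" using \<open>N > 0\<close> by simp
  define T where "T = (\<lambda>s. s\<^sup>2) ` (UNIV - {0 :: 'a})"
  have "s ^ (2 * h) = 1" if "s \<noteq> 0" for s :: 'a
    using finite_field_power_eq_1[OF that] h(1) by (simp add: N_def)
  then have "T \<subseteq> {u. u ^ h = 1}"
    by (auto simp: T_def simp flip: power_mult)
  moreover have "card {u :: 'a. u ^ h = 1} \<le> card T"
  proof -
    have "N = card (UNIV - {0 :: 'a})" by (simp add: N_def card_Diff_singleton)
    also have "\<dots> = (\<Sum>y\<in>T. card {s \<in> UNIV - {0}. s\<^sup>2 = y})"
      unfolding T_def by (subst card_eq_sum, subst sum.image_gen[where g = "\<lambda>s. s\<^sup>2"]) auto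
    also have "\<dots> \<le> (\<Sum>y\<in>T. 2)"
    proof (rule sum_mono)
      fix y assume "y \<in> T"
      then obtain r where "y = r\<^sup>2" by (auto simp: T_def)
      then have "{s \<in> UNIV - {0}. s\<^sup>2 = y} \<subseteq> {r, - r}" by (auto simp: power2_eq_iff)
      then have "card {s \<in> UNIV - {0}. s\<^sup>2 = y} \<le> card {r, - r}" by (intro card_mono) auto
      also have "\<dots> \<le> 2" using card_length[of "[r, - r]"] by simp
      finally show "card {s \<in> UNIV - {0}. s\<^sup>2 = y} \<le> 2" .
    qed
    finally have "h \<le> card T" using h by simp
    then show ?thesis using card_roots_of_unity_le[OF \<open>h > 0\<close>, where 'a = 'a] by linarith
  qed
  ultimately have "T = {u. u ^ h = 1}" by (intro card_seteq) auto
  moreover have "u ^ h = 1" using h(2) assms(1) by (auto simp: power_mult)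
  ultimately have "u \<in> T" by simp
  then show ?thesis by (auto simp: T_def)
qed

lemma CHAR_eq_of_CARD_prime_power:
  assumes "prime p" and "CARD('a :: {field, finite}) = p ^ n"
  shows "CHAR('a) = p"
proof -
  have "CHAR('a) > 0" by (rule finite_imp_CHAR_pos) simp
  then have "prime CHAR('a)" by (rule prime_CHAR_semidom)
  moreover have "CHAR('a) dvd p ^ n" using CHAR_dvd_CARD[where 'a = 'a] assms(2) by simp
  ultimately show ?thesis using assms(1) prime_dvd_power primes_dvd_imp_eq by blast
qed

section \<open>Unions of cosets of a subspace\<close>

text \<open>\<open>V\<close> is an \<open>F\<close>-subspace of dimension \<open>e\<close>,
  described by closure properties only. It grows by one dimension at a time: while there is room,
  some \<open>b\<close> lies outside \<open>V\<close>, and \<open>V + F * b\<close> has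
  \<open>card F\<close> times as many elements.\<close>

lemma exists_additive_subgroup_closed_under_scaling:
  fixes F :: "'a :: {field, finite} set"
  assumes F: "0 \<in> F" "1 \<in> F"
    and F_diff: "\<And>x y. x \<in> F \<Longrightarrow> y \<in> F \<Longrightarrow> x - y \<in> F"
    and F_mult: "\<And>x y. x \<in> F \<Longrightarrow> y \<in> F \<Longrightarrow> x * y \<in> F"
    and F_inv: "\<And>x. x \<in> F \<Longrightarrow> inverse x \<in> F"
    and "card F ^ e \<le> CARD('a)"
  shows "\<exists>V. card V = card F ^ e \<and> 0 \<in> V \<and> (\<forall>v\<in>V. \<forall>w\<in>V. v - w \<in> V) \<and>
    (\<forall>s\<in>F. \<forall>v\<in>V. s * v \<in> V)"
  using assms(6)
proof (induction e)
  case 0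
  show ?case by (intro exI[of _ "{0}"]) auto
next
  case (Suc e)
  have "card {0, 1 :: 'a} \<le> card F" by (rule card_mono) (use F in auto)
  then have F2: "2 \<le> card F" by simp
  then have less: "card F ^ e < card F ^ Suc e" by simp
  then have "card F ^ e \<le> CARD('a)" using Suc.prems by linarith
  from Suc.IH[OF this] obtain V where V: "card V = card F ^ e" "0 \<in> V"
    and V_diff: "\<And>v w. v \<in> V \<Longrightarrow> w \<in> V \<Longrightarrow> v - w \<in> V"
    and V_scale: "\<And>s v. s \<in> F \<Longrightarrow> v \<in> V \<Longrightarrow> s * v \<in> V"
    by blast
  from V(1) less Suc.prems have "V \<noteq> UNIV" by auto
  then obtain b where b: "b \<notin> V" by blast
  define g where "g = (\<lambda>(v, c). v + c * b)"
  have inj: "inj_on g (V \<times> F)"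
  proof (rule inj_onI)
    fix x y assume "x \<in> V \<times> F" "y \<in> V \<times> F" "g x = g y"
    then obtain v c w d where x: "x = (v, c)" "y = (w, d)" "v \<in> V" "w \<in> V" "c \<in> F" "d \<in> F"
      and eq: "v + c * b = w + d * b" by (auto simp: g_def)
    show "x = y"
    proof (cases "c = d")
      case False
      \<comment> \<open>Two representations with different coefficients could be solved for
        \<open>b\<close>, which would put \<open>b\<close> into \<open>V\<close>.\<close>
      have "b = inverse (c - d) * (w - v)"
        using eq False by (simp add: field_simps)
      then have "b \<in> V"
        using x by (auto intro!: V_scale F_inv F_diff V_diff)
      with b show ?thesis by simp
    qed (use eq x in auto)
  qed
  show ?case
  proof (intro exI[of _ "g ` (V \<times> F)"] conjI ballI)
    show "card (g ` (V \<times> F)) = card F ^ Suc e"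
      using inj V by (simp add: card_image card_cartesian_product)
    show "0 \<in> g ` (V \<times> F)"
      using V F by (intro image_eqI[of _ _ "(0, 0)"]) (auto simp: g_def)
  next
    fix x y assume "x \<in> g ` (V \<times> F)" "y \<in> g ` (V \<times> F)"
    then obtain v c w d where "v \<in> V" "w \<in> V" "c \<in> F" "d \<in> F" "x = v + c * b" "y = w + d * b"
      by (auto simp: g_def)
    then show "x - y \<in> g ` (V \<times> F)"
      by (intro image_eqI[of _ _ "(v - w, c - d)"]) (auto simp: g_def algebra_simps V_diff F_diff)
  next
    fix s x assume s: "s \<in> F" and "x \<in> g ` (V \<times> F)"
    then obtain v c where "v \<in> V" "c \<in> F" "x = v + c * b" by (auto simp: g_def)
    with s show "s * x \<in> g ` (V \<times> F)"
      by (intro image_eqI[of _ _ "(s * v, s * c)"]) (auto simp: g_def algebra_simps V_scale F_mult)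
  qed
qed

text \<open>The substitution of \<open>u * z\<close> for \<open>z\<close> permutes the roots of
  unity and extracts one \<open>u\<close> from each factor; the extra \<open>u\<close> on the left
  completes the power. If there are \<open>n\<close> roots, that power is 1.\<close>

lemma prod_differences_roots_of_unity:
  fixes u :: "'a :: field"
  assumes "u ^ n = 1" and "n > 0"
  shows "u * (\<Prod>z\<in>{z. z ^ n = 1} - {u}. u - z) =
    u ^ card {z :: 'a. z ^ n = 1} * (\<Prod>z\<in>{z. z ^ n = 1} - {1}. 1 - z)"
proof -
  let ?M = "{z :: 'a. z ^ n = 1}"
  have [simp]: "u \<noteq> 0" using assms by (auto simp: power_0_left)
  have fin: "finite ?M"
    using poly_roots_finite[OF degree_monom_minus_1(2)[OF assms(2), where 'a = 'a]]
    by (simp add: Polynomial.poly_monom)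
  have "(\<Prod>z\<in>?M - {u}. u - z) = (\<Prod>z\<in>?M - {1}. u * (1 - z))"
    by (rule prod.reindex_bij_witness[of _ "\<lambda>z. u * z" "\<lambda>z. z / u"])
      (use assms(1) in \<open>auto simp: power_mult_distrib power_divide algebra_simps\<close>)
  also have "\<dots> = u ^ (card ?M - 1) * (\<Prod>z\<in>?M - {1}. 1 - z)"
    using fin by (simp add: prod.distrib card_Diff_singleton)
  finally have "u * (\<Prod>z\<in>?M - {u}. u - z) = u ^ Suc (card ?M - 1) * (\<Prod>z\<in>?M - {1}. 1 - z)"
    by simp
  moreover have "card ?M > 0" using fin by (auto simp: card_gt_0_iff intro: exI[of _ 1])
  ultimately show ?thesis by simp
qed

text \<open>The factor pairing with the coset of \<open>u'\<close> is \<open>f ((u - u') * b)\<close>, where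
  \<open>f x = (\<Prod>w\<in>V. x + w)\<close> satisfies \<open>f (s * b) = s * f b\<close> for all \<open>s\<close> in \<open>F - {0}\<close>.\<close>

lemma prod_differences_union_of_cosets:
  fixes F V M :: "'a :: field set" and b :: 'a
  assumes fin: "finite V" "finite M"
    and V: "0 \<in> V"
    and V_diff: "\<And>v w. v \<in> V \<Longrightarrow> w \<in> V \<Longrightarrow> v - w \<in> V"
    and V_scale: "\<And>s v. s \<in> F \<Longrightarrow> v \<in> V \<Longrightarrow> s * v \<in> V"
    and F_inv: "\<And>x. x \<in> F \<Longrightarrow> inverse x \<in> F"
    and F_pow: "\<And>x. x \<in> F \<Longrightarrow> x ^ card V = x"
    and M: "\<And>x y. x \<in> M \<Longrightarrow> y \<in> M \<Longrightarrow> x - y \<in> F"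
    and b: "b \<notin> V"
    and uv: "u \<in> M" "v \<in> V"
  defines "A \<equiv> (\<lambda>(u, v). u * b + v) ` (M \<times> V)"
  shows "inj_on (\<lambda>(u, v). u * b + v) (M \<times> V)"
    and "(\<Prod>c\<in>A - {u * b + v}. u * b + v - c) =
      \<Prod>(V - {0}) * (\<Prod>w\<in>V. b + w) ^ (card M - 1) * (\<Prod>z\<in>M - {u}. u - z)"
proof -
  define g where "g = (\<lambda>(u, v). u * b + v)"
  have inj: "inj_on g (M \<times> V)"
  proof (rule inj_onI)
    fix x y assume "x \<in> M \<times> V" "y \<in> M \<times> V" "g x = g y"
    then obtain v c w d where x: "x = (c, v)" "y = (d, w)" "v \<in> V" "w \<in> V" "c \<in> M" "d \<in> M"
      and eq: "c * b + v = d * b + w" by (auto simp: g_def)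
    show "x = y"
    proof (cases "c = d")
      case False
      have "b = inverse (c - d) * (w - v)"
        using eq False by (simp add: field_simps)
      then have "b \<in> V"
        using x by (auto intro!: V_scale F_inv M V_diff)
      with b show ?thesis by simp
    qed (use eq x in auto)
  qed
  then show "inj_on (\<lambda>(u, v). u * b + v) (M \<times> V)" by (simp add: g_def)
  have "A - {u * b + v} = g ` (M \<times> V - {(u, v)})"
    using inj_on_image_set_diff[OF inj, of "M \<times> V" "{(u, v)}"] uv by (auto simp: A_def g_def)
  then have "(\<Prod>c\<in>A - {u * b + v}. u * b + v - c) =
      (\<Prod>x\<in>M \<times> V - {(u, v)}. u * b + v - g x)"
    by (simp add: prod.reindex inj_on_subset[OF inj])
  \<comment> \<open>The other points of the same coset give \<open>\<Prod>(V - {0})\<close>; each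
    remaining coset contributes a full product over \<open>V\<close>.\<close>
  also have "M \<times> V - {(u, v)} = {u} \<times> (V - {v}) \<union> (M - {u}) \<times> V"
    using uv by auto
  also have "(\<Prod>x\<in>{u} \<times> (V - {v}) \<union> (M - {u}) \<times> V. u * b + v - g x) =
      (\<Prod>x\<in>{u} \<times> (V - {v}). u * b + v - g x) * (\<Prod>x\<in>(M - {u}) \<times> V. u * b + v - g x)"
    by (rule prod.union_disjoint) (use fin in auto)
  also have "(\<Prod>x\<in>{u} \<times> (V - {v}). u * b + v - g x) = (\<Prod>w\<in>V - {v}. v - w)"
    by (rule prod.reindex_bij_witness[of _ "\<lambda>w. (u, w)" snd]) (auto simp: g_def)
  also have "\<dots> = \<Prod>(V - {0})"
    by (rule prod.reindex_bij_witness[of _ "\<lambda>w. v - w" "\<lambda>w. v - w"]) (use uv V_diff in auto)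
  also have "(\<Prod>x\<in>(M - {u}) \<times> V. u * b + v - g x) = (\<Prod>z\<in>M - {u}. \<Prod>w\<in>V. u * b + v - g (z, w))"
    by (simp add: prod.cartesian_product)
  also have "\<dots> = (\<Prod>z\<in>M - {u}. (u - z) * (\<Prod>w\<in>V. b + w))"
  proof (rule prod.cong)
    fix z assume z: "z \<in> M - {u}"
    define s where "s = u - z"
    have s: "s \<in> F" "s \<noteq> 0" using z uv M by (auto simp: s_def)
    have cancel: "s * (inverse s * x) = x" "inverse s * (s * x) = x" for x
      using s(2) by (simp_all flip: mult.assoc)
    have shift: "u * b + v - g (z, w) = s * b + (v - w)" for w
      by (simp add: g_def s_def algebra_simps)
    \<comment> \<open>The map sending \<open>w\<close> to \<open>v - s * w\<close> permutes
      \<open>V\<close>. Afterwards \<open>s\<close> occurs \<open>card V\<close> times, and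
      \<open>s ^ card V = s\<close>.\<close>
    have "(\<Prod>w\<in>V. u * b + v - g (z, w)) = (\<Prod>w\<in>V. s * (b + w))"
      by (rule prod.reindex_bij_witness[of _ "\<lambda>w. v - s * w" "\<lambda>w. inverse s * (v - w)"])
        (use s uv in \<open>simp_all add: shift cancel distrib_left V_diff V_scale F_inv\<close>)
    then show "(\<Prod>w\<in>V. u * b + v - g (z, w)) = (u - z) * (\<Prod>w\<in>V. b + w)"
      using F_pow[OF s(1)] by (simp add: prod.distrib s_def)
  qed simp
  also have "\<dots> = (\<Prod>z\<in>M - {u}. u - z) * (\<Prod>w\<in>V. b + w) ^ (card M - 1)"
    using fin uv by (simp add: prod.distrib)
  finally show "(\<Prod>c\<in>A - {u * b + v}. u * b + v - c) =
      \<Prod>(V - {0}) * (\<Prod>w\<in>V. b + w) ^ (card M - 1) * (\<Prod>z\<in>M - {u}. u - z)"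
    by (simp add: mult_ac)
qed

section \<open>Generalized Reed-Solomon codes\<close>

definition lagrange_poly :: "'a :: field set \<Rightarrow> ('a \<Rightarrow> 'a) \<Rightarrow> 'a poly" where
  "lagrange_poly A f =
    (\<Sum>a\<in>A. Polynomial.smult (f a / (\<Prod>b\<in>A - {a}. a - b)) (\<Prod>b\<in>A - {a}. [:- b, 1:]))"

lemma degree_prod_linear:
  "degree (\<Prod>b\<in>B. [:- b, 1 :: 'a :: field:]) = card B"
proof -
  have "degree (\<Prod>b\<in>B. [:- b, 1 :: 'a :: field:]) = (\<Sum>b\<in>B. degree [:- b, 1 :: 'a:])"
    by (rule degree_prod_eq_sum_degree) auto
  then show ?thesis by simp
qed

lemma degree_lagrange_poly:
  assumes "finite A" "A \<noteq> {}"
  shows "degree (lagrange_poly A f) < card A"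
proof -
  have "degree (lagrange_poly A f) \<le> card A - 1"
    unfolding lagrange_poly_def
  proof (rule degree_sum_le)
    fix a assume "a \<in> A"
    then show "degree (Polynomial.smult (f a / (\<Prod>b\<in>A - {a}. a - b)) (\<Prod>b\<in>A - {a}. [:- b, 1:])) \<le> card A - 1"
      by (intro order.trans[OF Polynomial.degree_smult_le]) (simp add: degree_prod_linear card_Diff_singleton)
  qed fact
  moreover have "card A > 0" using assms by (simp add: card_gt_0_iff)
  ultimately show ?thesis by simp
qed

lemma poly_lagrange_poly:
  assumes "finite A" "a \<in> A"
  shows "poly (lagrange_poly A f) a = f a"
proof -
  have "poly (lagrange_poly A f) a =
      (\<Sum>c\<in>A. f c / (\<Prod>b\<in>A - {c}. c - b) * (\<Prod>b\<in>A - {c}. a - b))"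
    by (simp add: lagrange_poly_def poly_sum poly_prod)
  also have "\<dots> = (\<Sum>c\<in>A. if c = a then f a else 0)"
    by (rule sum.cong) (use assms in \<open>auto simp: prod_zero_iff\<close>)
  finally show ?thesis using assms by simp
qed

text \<open>Each product of linear factors is monic of degree \<open>card A - 1\<close>, so only the
  scalars in front survive.\<close>

lemma coeff_lagrange_poly:
  assumes "finite A"
  shows "poly.coeff (lagrange_poly A f) (card A - 1) = (\<Sum>a\<in>A. f a / (\<Prod>b\<in>A - {a}. a - b))"
proof -
  have "poly.coeff (\<Prod>b\<in>A - {a}. [:- b, 1:]) (card A - 1) = 1" if "a \<in> A" for a
    using lead_coeff_prod[of "\<lambda>b. [:- b, 1:]" "A - {a}"] that
    by (simp add: degree_prod_linear card_Diff_singleton)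
  then show ?thesis by (simp add: lagrange_poly_def coeff_sum)
qed

text \<open>A polynomial of degree below \<open>card A\<close> is its own interpolant, so the two
  expressions for its coefficient at \<open>card A - 1\<close> agree.\<close>

lemma sum_poly_div_prod_differences:
  fixes p :: "'a :: field poly"
  assumes "finite A" "degree p < card A"
  shows "(\<Sum>a\<in>A. poly p a / (\<Prod>b\<in>A - {a}. a - b)) = poly.coeff p (card A - 1)"
proof -
  have "lagrange_poly A (poly p) = p"
    by (rule poly_eqI_degree[of A])
      (use assms in \<open>auto simp: poly_lagrange_poly intro!: degree_lagrange_poly\<close>)
  then show ?thesis using coeff_lagrange_poly[OF assms(1), of "poly p"] by simp
qed

text \<open>The list orders the evaluation points as coordinates, \<open>w\<close> holds the column
  multipliers, and \<open>h\<close> becomes the dimension.\<close>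

locale reed_solomon =
  fixes xs :: "'a :: field list" and w :: "'a \<Rightarrow> 'a" and h :: nat
  assumes distinct: "distinct xs"
    and w_nonzero: "\<And>a. a \<in> set xs \<Longrightarrow> w a \<noteq> 0"
    and h_pos: "h > 0" and h_le: "h \<le> length xs"
begin

definition codeword :: "'a poly \<Rightarrow> 'a vec" where
  "codeword f = vec (length xs) (\<lambda>i. w (xs ! i) * poly f (xs ! i))"

text \<open>The zero polynomial has degree 0, so it satisfies the degree bound because
  \<open>h > 0\<close>.\<close>

definition code :: "'a vec set" where
  "code = codeword ` {f. degree f < h}"

lemma codeword_eq_iff:
  "codeword f = codeword g \<longleftrightarrow> (\<forall>a\<in>set xs. poly f a = poly g a)"
  using w_nonzero by (auto simp: codeword_def vec_eq_iff all_set_conv_all_nth)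

lemma codeword_inj:
  assumes "codeword f = codeword g" "degree f < length xs" "degree g < length xs"
  shows "f = g"
  by (rule poly_eqI_degree[of "set xs"])
    (use assms distinct in \<open>auto simp: codeword_eq_iff distinct_card\<close>)

section \<open>Linearity and dimension\<close>

definition generator_matrix :: "'a mat" where
  "generator_matrix = mat (length xs) h (\<lambda>(i, j). w (xs ! i) * xs ! i ^ j)"

lemma generator_matrix_carrier: "generator_matrix \<in> carrier_mat (length xs) h"
  by (simp add: generator_matrix_def)

lemma generator_matrix_mult:
  assumes "c \<in> carrier_vec h"
  shows "generator_matrix *\<^sub>v c = codeword (\<Sum>j<h. Polynomial.monom (c $ j) j)"
  using assms
  by (intro eq_vecI)
    (auto simp: generator_matrix_def codeword_def scalar_prod_def poly_sum Polynomial.poly_monom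
      sum_distrib_left mult_ac atLeast0LessThan intro!: sum.cong)

lemma degree_message: "degree (\<Sum>j<h. Polynomial.monom (c j) j :: 'a poly) < h"
proof -
  have "degree (\<Sum>j<h. Polynomial.monom (c j) j) \<le> h - 1"
    by (rule degree_sum_le) (auto intro!: order.trans[OF Polynomial.degree_monom_le])
  then show ?thesis using h_pos by simp
qed

text \<open>This opens the way to the results on spans and rank. Messages are column vectors here,
  so the matrix is the transpose of the customary generator matrix.\<close>

lemma code_eq_col_space: "code = vec_space.col_space (length xs) generator_matrix"
proof -
  interpret vec_space "TYPE('a)" "length xs" .
  have "code = {y \<in> carrier_vec (length xs). \<exists>c\<in>carrier_vec h. generator_matrix *\<^sub>v c = y}"
  proof (intro equalityI subsetI)
    fix y assume "y \<in> code"
    then obtain f where f: "degree f < h" "y = codeword f" by (auto simp: code_def)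
    have "f = (\<Sum>j<h. Polynomial.monom (vec h (poly.coeff f) $ j) j)"
      using poly_as_sum_of_monoms'[of f "h - 1"] f h_pos
      by (simp add: lessThan_Suc_atMost[symmetric])
    then have "generator_matrix *\<^sub>v vec h (poly.coeff f) = y"
      using f by (simp add: generator_matrix_mult)
    moreover have "y \<in> carrier_vec (length xs)" by (simp add: f codeword_def)
    ultimately show "y \<in> {y \<in> carrier_vec (length xs). \<exists>c\<in>carrier_vec h. generator_matrix *\<^sub>v c = y}"
      by force
  next
    fix y assume "y \<in> {y \<in> carrier_vec (length xs). \<exists>c\<in>carrier_vec h. generator_matrix *\<^sub>v c = y}"
    then show "y \<in> code"
      using degree_message by (auto simp: generator_matrix_mult code_def)
  qed
  then show ?thesis
    using col_space_eq[OF generator_matrix_carrier] generator_matrix_carrier by simp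
qed

lemma subspace_code: "VectorSpace.subspace class_ring code (module_vec TYPE('a) (length xs))"
proof -
  interpret vec_space "TYPE('a)" "length xs" .
  have "set (cols generator_matrix) \<subseteq> carrier_vec (length xs)"
    using cols_dim[of generator_matrix] generator_matrix_carrier by simp
  then show ?thesis
    unfolding code_eq_col_space col_space_def by (intro span_is_subspace) simp
qed

text \<open>The columns are the codewords of the monomials. A dependence among them is a polynomial
  of degree below \<open>h\<close> that vanishes at \<open>length xs \<ge> h\<close> points, hence
  is zero.\<close>

lemma dim_code:
  "vectorspace.dim class_ring ((module_vec TYPE('a) (length xs))\<lparr>carrier := code\<rparr>) = h"
proof -
  interpret vec_space "TYPE('a)" "length xs" .
  have col: "cols generator_matrix ! j = codeword (Polynomial.monom 1 j)" if "j < h" for j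
    using that by (intro eq_vecI) (auto simp: generator_matrix_def codeword_def Polynomial.poly_monom)
  have len: "length (cols generator_matrix) = h"
    using generator_matrix_carrier by simp
  \<comment> \<open>Independence concerns the set of columns, in which equal columns would be
    merged.\<close>
  have dist: "distinct (cols generator_matrix)"
    unfolding distinct_conv_nth len
  proof (intro allI impI notI)
    fix i j assume ij: "i < h" "j < h" "i \<noteq> j"
      and "cols generator_matrix ! i = cols generator_matrix ! j"
    then have "Polynomial.monom 1 i = (Polynomial.monom 1 j :: 'a poly)"
      using h_le by (intro codeword_inj) (simp_all add: col Polynomial.degree_monom_eq)
    then have "degree (Polynomial.monom 1 i :: 'a poly) = degree (Polynomial.monom 1 j :: 'a poly)"
      by (rule arg_cong)
    with ij show False by (simp add: Polynomial.degree_monom_eq)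
  qed
  have "lin_indpt (set (cols generator_matrix))"
  proof
    assume "lin_dep (set (cols generator_matrix))"
    then obtain c where c: "c \<in> carrier_vec h" "c \<noteq> 0\<^sub>v h" "generator_matrix *\<^sub>v c = 0\<^sub>v (length xs)"
      using lin_depE[OF generator_matrix_carrier _ dist] by blast
    let ?f = "\<Sum>j<h. Polynomial.monom (c $ j) j"
    have "codeword ?f = codeword 0"
      using c by (simp add: generator_matrix_mult) (auto simp: codeword_def)
    then have f0: "?f = 0"
      using degree_message[of "\<lambda>j. c $ j"] h_le h_pos by (intro codeword_inj) auto
    have "c $ i = 0" if "i < h" for i
    proof -
      have "poly.coeff ?f i = (\<Sum>j<h. if j = i then c $ j else 0)"
        by (simp add: coeff_sum)
      then show ?thesis using that by (simp add: f0)
    qed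
    then have "c = 0\<^sub>v h" using c by (intro eq_vecI) auto
    with c show False by simp
  qed
  then have "rank generator_matrix = h"
    by (rule lin_indpt_full_rank[OF generator_matrix_carrier dist])
  then show ?thesis
    unfolding rank_def code_eq_col_space col_space_def by simp
qed

section \<open>Minimum distance\<close>

lemma hamming_distance_codeword:
  "hamming_distance (codeword f) (codeword g) =
    length xs - card {a \<in> set xs. poly (f - g) a = 0}"
proof -
  let ?I = "{i. i < length xs \<and> poly (f - g) (xs ! i) \<noteq> 0}"
  have "hamming_distance (codeword f) (codeword g) = card ?I"
    unfolding hamming_distance_def
    by (rule arg_cong[where f = card]) (use w_nonzero in \<open>auto simp: codeword_def\<close>)
  also have "\<dots> = card ((!) xs ` ?I)"
    by (rule card_image[symmetric]) (use distinct in \<open>auto intro!: inj_on_nth\<close>)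
  also have "(!) xs ` ?I = set xs - {a \<in> set xs. poly (f - g) a = 0}"
    by (auto simp: in_set_conv_nth)
  also have "card \<dots> = length xs - card {a \<in> set xs. poly (f - g) a = 0}"
    by (subst card_Diff_subset) (auto simp: distinct_card distinct)
  finally show ?thesis .
qed

text \<open>Distinct messages agree in at most \<open>h - 1\<close> points. The polynomial with
  simple roots at the first \<open>h - 1\<close> points attains this bound against the zero
  word.\<close>

lemma minimum_distance_code: "minimum_distance code = length xs - h + 1"
  unfolding minimum_distance_def
proof (rule cInf_eq_minimum)
  define T where "T = set (take (h - 1) xs)"
  define f where "f = (\<Prod>b\<in>T. [:- b, 1:])"
  have T: "T \<subseteq> set xs" "finite T" "card T = h - 1"
    using distinct distinct_card[of "take (h - 1) xs"] h_le by (auto simp: T_def dest: in_set_takeD)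
  have f: "degree f = h - 1" "f \<noteq> 0"
    using T by (auto simp: f_def degree_prod_linear)
  have "{a \<in> set xs. poly f a = 0} = T"
    using T by (auto simp: f_def poly_prod prod_zero_iff)
  then have "hamming_distance (codeword f) (codeword 0) = length xs - h + 1"
    using h_pos h_le T by (simp add: hamming_distance_codeword)
  moreover have "codeword f \<noteq> codeword 0"
  proof
    assume "codeword f = codeword 0"
    then have "f = 0" by (rule codeword_inj) (use f h_pos h_le in auto)
    with f show False by simp
  qed
  ultimately show "length xs - h + 1 \<in>
      {hamming_distance x y |x y. x \<in> code \<and> y \<in> code \<and> x \<noteq> y}"
    using f h_pos unfolding code_def
    by (intro CollectI exI[of _ "codeword f"] exI[of _ "codeword 0"]) auto
next
  fix d assume "d \<in> {hamming_distance x y |x y. x \<in> code \<and> y \<in> code \<and> x \<noteq> y}"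
  then obtain f g where fg: "degree f < h" "degree g < h" "codeword f \<noteq> codeword g"
    and d: "d = hamming_distance (codeword f) (codeword g)"
    by (auto simp: code_def)
  have ne: "f - g \<noteq> 0" using fg by auto
  have "card {a \<in> set xs. poly (f - g) a = 0} \<le> card {a. poly (f - g) a = 0}"
    by (rule card_mono) (use poly_roots_finite[OF ne] in auto)
  also have "\<dots> \<le> degree (f - g)" by (rule card_poly_roots_bound[OF ne])
  also have "\<dots> < h" using fg(1,2) by (rule degree_diff_less)
  finally show "length xs - h + 1 \<le> d"
    unfolding d hamming_distance_codeword using h_le by linarith
qed

lemma code_is_MDS: "MDS_code (length xs) code"
  unfolding MDS_code_def linear_code_def
  using subspace_code dim_code minimum_distance_code h_le by auto

section \<open>Inner products and self-duality\<close>

lemma scalar_prod_codeword: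
  "codeword f \<bullet> codeword g = (\<Sum>a\<in>set xs. (w a)\<^sup>2 * poly (f * g) a)"
proof -
  have "codeword f \<bullet> codeword g = (\<Sum>i<length xs. (w (xs ! i))\<^sup>2 * poly (f * g) (xs ! i))"
    by (simp add: scalar_prod_def codeword_def atLeast0LessThan power2_eq_square mult_ac)
  also have "\<dots> = (\<Sum>a\<in>set xs. (w a)\<^sup>2 * poly (f * g) a)"
    by (rule sum.reindex_bij_betw[OF bij_betw_nth]) (use distinct in auto)
  finally show ?thesis .
qed

lemma codeword_surj:
  assumes "y \<in> carrier_vec (length xs)"
  obtains f where "degree f < length xs" "y = codeword f"
proof
  \<comment> \<open>The position of a point in \<open>xs\<close>, used to turn the coordinates of
    \<open>y\<close> into values to be interpolated.\<close>
  define i where "i = the_inv_into {..<length xs} ((!) xs)"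
  have i: "i (xs ! j) = j" if "j < length xs" for j
    unfolding i_def using that distinct by (intro the_inv_into_f_f inj_on_nth) auto
  define f where "f = lagrange_poly (set xs) (\<lambda>a. y $ i a / w a)"
  have "set xs \<noteq> {}" using h_pos h_le by auto
  then show "degree f < length xs"
    using degree_lagrange_poly[of "set xs"] distinct by (simp add: f_def distinct_card)
  show "y = codeword f"
    using assms w_nonzero by (intro eq_vecI) (auto simp: codeword_def f_def poly_lagrange_poly i)
qed

lemma code_is_self_dual:
  assumes h: "2 * h = length xs" and K: "K \<noteq> 0"
    and w: "\<And>a. a \<in> set xs \<Longrightarrow> (w a)\<^sup>2 * (\<Prod>b\<in>set xs - {a}. a - b) = K"
  shows "self_dual (length xs) code"
proof -
  have card: "card (set xs) = length xs" using distinct by (rule distinct_card)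
  have sp: "codeword f \<bullet> codeword g = K * poly.coeff (f * g) (length xs - 1)"
    if "degree (f * g) < length xs" for f g
  proof -
    have "codeword f \<bullet> codeword g =
        K * (\<Sum>a\<in>set xs. poly (f * g) a / (\<Prod>b\<in>set xs - {a}. a - b))"
      unfolding scalar_prod_codeword sum_distrib_left
    proof (rule sum.cong)
      fix a assume "a \<in> set xs"
      moreover have "(\<Prod>b\<in>set xs - {a}. a - b) \<noteq> 0" by (auto simp: prod_zero_iff)
      ultimately show "(w a)\<^sup>2 * poly (f * g) a =
          K * (poly (f * g) a / (\<Prod>b\<in>set xs - {a}. a - b))"
        by (simp add: w[symmetric])
    qed simp
    then show ?thesis using sum_poly_div_prod_differences[of "set xs" "f * g"] that card by simp
  qed
  have "codeword f \<in> dual_code (length xs) code" if f: "degree f < h" for f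
    unfolding dual_code_def vec_module.orthogonal_complement_def code_def
  proof safe
    fix g :: "'a poly" assume g: "degree g < h"
    have "degree (f * g) \<le> degree f + degree g" by (rule Polynomial.degree_mult_le)
    \<comment> \<open>Both degrees are at most \<open>h - 1\<close>, so the product stays within
      \<open>2 * h - 2\<close>, just below the coefficient that \<open>sp\<close> reads off.\<close>
    then have deg: "degree (f * g) < length xs - 1" using f g h by linarith
    then show "codeword f \<bullet> codeword g = 0"
      by (subst sp) (auto simp: coeff_eq_0)
  qed (simp add: codeword_def)
  moreover have "y \<in> code" if y: "y \<in> dual_code (length xs) code" for y
  proof -
    have "y \<in> carrier_vec (length xs)"
      using y by (simp add: dual_code_def vec_module.orthogonal_complement_def)
    then obtain f where f: "degree f < length xs" "y = codeword f" by (rule codeword_surj)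
    have "degree f < h"
    proof (rule ccontr)
      assume large: "\<not> degree f < h"
      \<comment> \<open>Since \<open>degree f \<ge> h\<close>, the exponent is at most
        \<open>2 * h - 1 - h = h - 1\<close>, so \<open>g\<close> is an admissible message.\<close>
      define g :: "'a poly" where "g = Polynomial.monom 1 (length xs - 1 - degree f)"
      have "degree g < h" using large h h_pos by (simp add: g_def Polynomial.degree_monom_eq)
      then have "y \<bullet> codeword g = 0"
        using y by (auto simp: dual_code_def vec_module.orthogonal_complement_def code_def)
      moreover have "f \<noteq> 0" using large h_pos by auto
      then have deg: "degree (f * g) = length xs - 1"
        using f by (subst degree_mult_eq) (auto simp: g_def Polynomial.degree_monom_eq)
      moreover have "lead_coeff (f * g) \<noteq> 0"
        using \<open>f \<noteq> 0\<close> by (simp add: g_def)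
      ultimately show False using K sp[of f g] f h h_pos by simp
    qed
    with f show ?thesis by (simp add: code_def)
  qed
  ultimately show ?thesis by (auto simp: self_dual_def code_def)
qed

end

section \<open>The self-dual code\<close>

theorem theorem5:
  fixes p k m q t e :: nat
  assumes "prime p" and "odd p"
    and "k > 0" and "m > 0"
    and "q = p ^ (k * m)"
    and "CARD('a :: {field, finite}) = q"
    and "t > 0" and "2 * t dvd p ^ k - 1"
    and "e \<le> m - 1"
    and "even ((q - 1) div (2 * t))"
  shows "\<exists>C :: 'a vec set. MDS_code (2 * t * p ^ (k * e)) C \<and> self_dual (2 * t * p ^ (k * e)) C"
proof -
  define r where "r = p ^ k"
  have r: "r > 1"
    unfolding r_def using prime_gt_1_nat[OF assms(1)] assms(3) by (rule one_less_power)
  have q: "CARD('a) = r ^ m" using assms(5,6) by (simp add: r_def power_mult)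
  have r_dvd: "r - 1 dvd CARD('a) - 1"
  proof -
    have "int r - 1 dvd int r ^ m - 1"
      using power_diff_1_eq[of "int r" m] by simp
    then have "int (r - 1) dvd int (r ^ m - 1)"
      using r by (simp add: of_nat_diff)
    then show ?thesis by (simp only: q of_nat_dvd_iff)
  qed
  have t_dvd: "2 * t dvd r - 1" using assms(8) by (simp add: r_def)
  then have M_dvd: "2 * t dvd CARD('a) - 1" using r_dvd by (rule dvd_trans)
  \<comment> \<open>The parity hypothesis in the form that makes every \<open>2 * t\<close>-th root
    of unity a square.\<close>
  have square_dvd: "2 * (2 * t) dvd CARD('a) - 1"
    using dvd_div_iff_mult[of "2 * t" "CARD('a) - 1" 2] M_dvd assms(6,7,10) by simp

  \<comment> \<open>The subfield of order \<open>r\<close> as the fixed points of the Frobenius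
    power; its nonzero elements are the roots of unity of order dividing \<open>r - 1\<close>, which
    gives its size.\<close>
  define F where "F = {x :: 'a. x ^ r = x}"
  define M where "M = {u :: 'a. u ^ (2 * t) = 1}"
  have F_alt: "F = insert 0 {x. x ^ (r - 1) = 1}"
    using r by (cases r) (auto simp: F_def power_0_left)
  have cardF: "card F = r"
    unfolding F_alt using r card_roots_of_unity[OF r_dvd] by (simp add: power_0_left)
  have cardM: "card M = 2 * t"
    unfolding M_def using M_dvd by (rule card_roots_of_unity)
  have F_diff: "x - y \<in> F" if "x \<in> F" "y \<in> F" for x y
  proof -
    have char: "CHAR('a) = p"
      using CHAR_eq_of_CARD_prime_power[OF assms(1)] assms(5,6) by simp
    \<comment> \<open>Additivity of the Frobenius power is applied to \<open>(x - y) + y\<close> to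
      obtain closure under differences.\<close>
    have "(x - y + y) ^ r = (x - y) ^ r + y ^ r"
      by (rule freshmans_dream') (simp_all add: char assms(1) r_def)
    then show ?thesis using that by (simp add: F_def eq_diff_eq)
  qed
  have F_mult: "x * y \<in> F" if "x \<in> F" "y \<in> F" for x y
    using that by (simp add: F_def power_mult_distrib)
  have F_inv: "inverse x \<in> F" if "x \<in> F" for x
    using that by (simp add: F_def power_inverse)
  have F_pow: "x ^ (r ^ i) = x" if "x \<in> F" for x i
    using that by (induction i) (simp_all add: F_def power_mult)
  have MF: "M \<subseteq> F"
    using t_dvd by (auto simp: F_alt M_def power_mult)
  \<comment> \<open>The strict inequality leaves an element \<open>b\<close> outside the subspace of
    size \<open>r ^ e\<close>.\<close>
  have re: "r ^ e < r ^ m" using r assms(4,9) by (intro power_strict_increasing) auto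
  have "0 \<in> F" "1 \<in> F" using r by (auto simp: F_def power_0_left)
  then have "\<exists>V. card V = card F ^ e \<and> 0 \<in> V \<and> (\<forall>v\<in>V. \<forall>w\<in>V. v - w \<in> V) \<and>
      (\<forall>s\<in>F. \<forall>v\<in>V. s * v \<in> V)"
    using F_diff F_mult F_inv re
    by (intro exists_additive_subgroup_closed_under_scaling) (auto simp: cardF q)
  then obtain V where cardV: "card V = r ^ e" and V0: "0 \<in> V"
    and V_diff: "\<And>v w. v \<in> V \<Longrightarrow> w \<in> V \<Longrightarrow> v - w \<in> V"
    and V_scale: "\<And>s v. s \<in> F \<Longrightarrow> v \<in> V \<Longrightarrow> s * v \<in> V"
    unfolding cardF by blast
  have "V \<noteq> UNIV" using cardV re q by auto
  then obtain b where b: "b \<notin> V" by blast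

  define A where "A = (\<lambda>(u, v). u * b + v) ` (M \<times> V)"
  have M1: "1 \<in> M" by (simp add: M_def)
  have M_diff: "x - y \<in> F" if "x \<in> M" "y \<in> M" for x y
    using that MF F_diff by blast
  have F_pow_card: "x ^ card V = x" if "x \<in> F" for x
    using F_pow[OF that] by (simp add: cardV)
  have cosets: "inj_on (\<lambda>(u, v). u * b + v) (M \<times> V)"
    "(\<Prod>c\<in>A - {u * b + v}. u * b + v - c) =
      \<Prod>(V - {0}) * (\<Prod>w\<in>V. b + w) ^ (card M - 1) * (\<Prod>z\<in>M - {u}. u - z)"
    if "u \<in> M" "v \<in> V" for u v
    unfolding A_def
    by (rule prod_differences_union_of_cosets[where F = F and M = M];
        use that V0 V_diff V_scale F_inv F_pow_card M_diff b in \<open>simp; fail\<close>)+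
  have cardA: "card A = 2 * t * r ^ e"
    unfolding A_def using cosets(1)[OF M1 V0]
    by (simp add: card_image card_cartesian_product cardM cardV)
  \<comment> \<open>The value of the product of differences at any point of the coset with
    \<open>u = 1\<close>.\<close>
  define K where "K = \<Prod>(V - {0}) * (\<Prod>w\<in>V. b + w) ^ (card M - 1) * (\<Prod>z\<in>M - {1}. 1 - z)"
  have "b + w \<noteq> 0" if "w \<in> V" for w
    using that b V_diff[OF V0 that] by (auto simp: eq_neg_iff_add_eq_0[symmetric])
  then have K: "K \<noteq> 0" by (auto simp: K_def prod_zero_iff)
  have "\<forall>a\<in>A. \<exists>s. s\<^sup>2 * (\<Prod>c\<in>A - {a}. a - c) = K"
  proof
    fix a assume "a \<in> A"
    then obtain u v where a: "a = u * b + v" and u: "u \<in> M" and v: "v \<in> V"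
      by (auto simp: A_def)
    obtain s where s: "s\<^sup>2 = u"
      using root_of_unity_is_square[of u "2 * t"] square_dvd u by (auto simp: M_def)
    \<comment> \<open>The power \<open>u ^ card M\<close> disappears because
      \<open>card M = 2 * t\<close>.\<close>
    have "u * (\<Prod>z\<in>M - {u}. u - z) = (\<Prod>z\<in>M - {1}. 1 - z)"
      using prod_differences_roots_of_unity[of u "2 * t"] u assms(7) cardM by (simp add: M_def)
    then have "s\<^sup>2 * (\<Prod>c\<in>A - {a}. a - c) = K"
      unfolding a cosets(2)[OF u v] K_def s by (simp add: mult_ac)
    then show "\<exists>s. s\<^sup>2 * (\<Prod>c\<in>A - {a}. a - c) = K" by blast
  qed
  then obtain w where w: "\<And>a. a \<in> A \<Longrightarrow> (w a)\<^sup>2 * (\<Prod>c\<in>A - {a}. a - c) = K"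
    by metis
  obtain xs where xs: "set xs = A" "distinct xs"
    using finite_distinct_list[of A] by auto
  have len: "length xs = 2 * t * p ^ (k * e)"
    using distinct_card[OF xs(2)] by (simp add: xs(1) cardA r_def power_mult)
  interpret reed_solomon xs w "t * r ^ e"
  proof
    show "w a \<noteq> 0" if "a \<in> set xs" for a
      using w[of a] K that xs(1) by auto
    show "t * r ^ e \<le> length xs" using len by (simp add: r_def power_mult)
  qed (use xs(2) assms(7) r in auto)
  have "self_dual (length xs) code"
    by (rule code_is_self_dual[OF _ K]) (use w in \<open>simp_all add: xs(1) len r_def power_mult\<close>)
  with code_is_MDS show ?thesis unfolding len by blast
qed

end
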